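(* Let $\mathscr{P}$ be a biclique-profile with start-index $s$ such that $\mathscr{P}_s=t-1$. For any $\mathscr{P}$-extremal cograph $G$ there are a finite index set $I$ and a mapping $\sigma: I\to[t-1]$ such that: (i) $G$ admits a decomposition $$G=\sum_{i\in I} G_{i,1}\times G_{i,2}$$ where $|G_{i,1}|=\sigma(i)$ and $|G_{i,2}|\ge\sigma(i)$ for all $i\in I$. (ii) For any $1\le j\le s-1$, the fiber satisfies $|\sigma^{-1}(j)|\le 1$.
   Context: Graphs are finite and simple; $|G|$ is the number of vertices of $G$; $[m]=\{1,\dots,m\}$; $\mathbb{N}_0=\{0,1,2,\dots\}$. A cograph is a graph with no induced path $P_4$ on four vertices. The sum $G_1+G_2$ is the disjoint union (and $\sum_{i}$ the iterated sum); the product (join) $G_1\times G_2$ is the disjoint union together with all edges between $V(G_1)$ and $V(G_2)$. $G_{i,1},G_{i,2}$ are cographs. $K_{s,t}$ is the complete bipartite graph with parts of sizes $s,t$, with $K_{0,t}$ the edgeless graph on $t$ vertices; $K_{s,t}\subseteq G$ means containment as a (not necessarily induced) subgraph. The biclique-sequence of $G$ is $\mathscr{S}(G)=(\mathscr{S}_s(G))_{s\in\mathbb{N}_0}$ with $\mathscr{S}_s(G)=\max\{t\in\mathbb{N}_0 : K_{s,t}\subseteq G\}$, where the maximum of the empty set is $-\infty$. A biclique-profile is a sequence $\mathscr{P}=(\mathscr{P}_j)_{j\in\mathbb{N}_0}$ with values in $\mathbb{N}_0\cup\{\infty,-\infty\}$ that is (weakly) decreasing and subdiagonal, i.e. $\mathscr{P}_j<l\implies\mathscr{P}_l<j$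 for all $j,l\in\mathbb{N}_0$ (equivalently $\mathscr{P}_j\ge l\implies\mathscr{P}_l\ge j$). A graph $G$ fulfills $\mathscr{P}$ if $\mathscr{S}_j(G)\le\mathscr{P}_j$ for all $j$. A cograph is $\mathscr{P}$-extremal if it fulfills $\mathscr{P}$ and has the maximum number of edges among all cographs with the same number of vertices that fulfill $\mathscr{P}$. The start-index of $\mathscr{P}$ is the minimal $i\in\mathbb{N}_0$ with $\mathscr{P}_i<\infty$.
   Formalization: In (i) the isolated vertices of G form an additional edgeless summand (empty if G has none); as printed, (i) fails for extremal cographs with isolated vertices, e.g. the one-vertex graph, since σ(i) ≥ 1 makes every product have at least two vertices and no isolated vertex. *)

theory Defs
  imports "HOL-Library.Extended_Real" "HOL-Library.FuncSet"
begin

datatype 'a graph = Graph (verts: "'a set") (edges: "'a set set")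

definition simple_graph :: "'a graph \<Rightarrow> bool" where
  "simple_graph G \<longleftrightarrow> finite (verts G) \<and> (\<forall>e\<in>edges G. e \<subseteq> verts G \<and> card e = 2)"

definition graph_iso :: "'a graph \<Rightarrow> 'b graph \<Rightarrow> bool" (infix "\<simeq>\<^sub>G" 50) where
  "G \<simeq>\<^sub>G H \<longleftrightarrow> (\<exists>f. bij_betw f (verts G) (verts H) \<and> edges H = (\<lambda>e. f ` e) ` edges G)"

definition contains_subgraph :: "'b graph \<Rightarrow> 'a graph \<Rightarrow> bool" where
  "contains_subgraph H G \<longleftrightarrow>
     (\<exists>f. inj_on f (verts H) \<and> f ` verts H \<subseteq> verts G \<and> (\<forall>e\<in>edges H. f ` e \<in> edges G))"

definition contains_induced :: "'b graph \<Rightarrow> 'a graph \<Rightarrow> bool" where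
  "contains_induced H G \<longleftrightarrow>
     (\<exists>f. inj_on f (verts H) \<and> f ` verts H \<subseteq> verts G \<and>
        (\<forall>u\<in>verts H. \<forall>v\<in>verts H. {u, v} \<in> edges H \<longleftrightarrow> {f u, f v} \<in> edges G))"

definition path4 :: "nat graph" where
  "path4 = Graph {0, 1, 2, 3} {{0, 1}, {1, 2}, {2, 3}}"

definition cograph :: "'a graph \<Rightarrow> bool" where
  "cograph G \<longleftrightarrow> simple_graph G \<and> \<not> contains_induced path4 G"

(* Sums and products are built on tagged vertices, so that the summands and factors are
   disjoint by construction; decompositions are therefore stated up to isomorphism. *)

definition graph_add :: "'a graph \<Rightarrow> 'b graph \<Rightarrow> ('a + 'b) graph" (infixl "\<oplus>\<^sub>G" 65) where
  "G \<oplus>\<^sub>G H = Graph (verts G <+> verts H) ((`) Inl ` edges G \<union> (`) Inr ` edges H)"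

definition graph_sum :: "'i set \<Rightarrow> ('i \<Rightarrow> 'a graph) \<Rightarrow> ('i \<times> 'a) graph" where
  "graph_sum I F = Graph (SIGMA i:I. verts (F i)) (\<Union>i\<in>I. (`) (Pair i) ` edges (F i))"

definition graph_join :: "'a graph \<Rightarrow> 'b graph \<Rightarrow> ('a + 'b) graph" (infixl "\<otimes>\<^sub>G" 70) where
  "G \<otimes>\<^sub>G H = Graph (verts G <+> verts H)
     ((`) Inl ` edges G \<union> (`) Inr ` edges H \<union>
      {{Inl u, Inr v} | u v. u \<in> verts G \<and> v \<in> verts H})"

definition edgeless :: "'a set \<Rightarrow> 'a graph" where
  "edgeless V = Graph V {}"

(* Sums of products of nonempty graphs have no isolated vertices, but extremal cographs can have
   some, e.g. the one-vertex graph; in a decomposition they form a separate edgeless summand,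
   which is empty if there are none. *)

definition isolated_vertices :: "'a graph \<Rightarrow> 'a set" where
  "isolated_vertices G = {v \<in> verts G. \<forall>e\<in>edges G. v \<notin> e}"

definition complete_bipartite :: "nat \<Rightarrow> nat \<Rightarrow> (nat + nat) graph" where
  "complete_bipartite s t = edgeless {..<s} \<otimes>\<^sub>G edgeless {..<t}"

definition biclique_seq :: "'a graph \<Rightarrow> nat \<Rightarrow> ereal" where
  "biclique_seq G s =
     (let T = {t. contains_subgraph (complete_bipartite s t) G}
      in if T = {} then -\<infinity> else ereal (real (Max T)))"

definition biclique_profile :: "(nat \<Rightarrow> ereal) \<Rightarrow> bool" where
  "biclique_profile P \<longleftrightarrow>
     (\<forall>j. P j \<in> range (\<lambda>n::nat. ereal (real n)) \<union> {\<infinity>, -\<infinity>}) \<and>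
     decseq P \<and>
     (\<forall>j l. P j < ereal (real l) \<longrightarrow> P l < ereal (real j))"

definition fulfills :: "'a graph \<Rightarrow> (nat \<Rightarrow> ereal) \<Rightarrow> bool" where
  "fulfills G P \<longleftrightarrow> (\<forall>j. biclique_seq G j \<le> P j)"

(* Competitors are taken over the vertex type of G only. This is no restriction: every graph
   with as many vertices as G is isomorphic to one on the vertex set of G. *)

definition extremal_cograph :: "(nat \<Rightarrow> ereal) \<Rightarrow> 'a graph \<Rightarrow> bool" where
  "extremal_cograph P G \<longleftrightarrow>
     cograph G \<and> fulfills G P \<and>
     (\<forall>H::'a graph. cograph H \<and> card (verts H) = card (verts G) \<and> fulfills H P
        \<longrightarrow> card (edges H) \<le> card (edges G))"

definition start_index :: "(nat \<Rightarrow> ereal) \<Rightarrow> nat \<Rightarrow> bool" where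
  "start_index P s \<longleftrightarrow> P s < \<infinity> \<and> (\<forall>i<s. \<not> P i < \<infinity>)"

end

theory Submission
  imports Defs
begin

text \<open>
  A \<open>P\<^sub>4\<close>-free graph on at least two vertices is a disjoint union or a join of two nonempty graphs.
  Splitting along disjoint unions as long as possible decomposes \<open>G\<close> into isolated vertices and
  blocks \<open>A \<times> B\<close>, where \<open>card A \<le> card B\<close>. A block with \<open>card A \<ge> t\<close> would contain \<open>K\<^sub>s\<^sub>,\<^sub>t\<close>, as
  subdiagonality forces \<open>s \<le> t\<close>. If two blocks \<open>A\<^sub>1 \<times> B\<^sub>1\<close> and \<open>A\<^sub>2 \<times> B\<^sub>2\<close> had
  \<open>card A\<^sub>1 = card A\<^sub>2 = j < s\<close>, replace them by \<open>E \<times> (B\<^sub>1 + B\<^sub>2 + E')\<close> with \<open>E\<close>, \<open>E'\<close> edgeless on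
  \<open>A\<^sub>1\<close>, \<open>A\<^sub>2\<close>. This gains \<open>j\<^sup>2\<close> edges and loses at most \<open>j (j - 1)\<close>. The profile only restricts
  bicliques with both sides larger than \<open>j\<close>; such a biclique has a vertex outside \<open>E\<close> on each side
  and hence lives in \<open>E \<times> B\<^sub>1\<close> or \<open>E \<times> B\<^sub>2\<close> (or in another block), so \<open>G\<close> contains a copy of it.
\<close>

section \<open>Splitting graphs without an induced path\<close>

text \<open>Formulated for a relation on a vertex set, so that it applies to \<open>R\<close> and to
  its complement alike. The complement of an irreflexive relation is reflexive;
  \<open>distinct\<close> keeps loops out of the pattern.\<close>

definition p4_free :: "('a \<Rightarrow> 'a \<Rightarrow> bool) \<Rightarrow> 'a set \<Rightarrow> bool" where
  "p4_free R V \<longleftrightarrow> \<not> (\<exists>a\<in>V. \<exists>b\<in>V. \<exists>c\<in>V. \<exists>d\<in>V. distinct [a, b, c, d] \<and>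
     R a b \<and> R b c \<and> R c d \<and> \<not> R a c \<and> \<not> R b d \<and> \<not> R a d)"

text \<open>For \<open>R = adj G\<close> this is a join, for the negated relation a disjoint union
  without edges in between.\<close>

definition splits :: "('a \<Rightarrow> 'a \<Rightarrow> bool) \<Rightarrow> 'a set \<Rightarrow> 'a set \<Rightarrow> 'a set \<Rightarrow> bool" where
  "splits R V A B \<longleftrightarrow> A \<union> B = V \<and> A \<inter> B = {} \<and> A \<noteq> {} \<and> B \<noteq> {} \<and> (\<forall>a\<in>A. \<forall>b\<in>B. R a b)"

lemma p4_freeD:
  assumes "p4_free R V" "a \<in> V" "b \<in> V" "c \<in> V" "d \<in> V"
    and "distinct [a, b, c, d]" "R a b" "R b c" "R c d"
  shows "R a c \<or> R b d \<or> R a d"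
  using assms unfolding p4_free_def by blast

lemma p4_free_subset: "p4_free R V \<Longrightarrow> W \<subseteq> V \<Longrightarrow> p4_free R W"
  unfolding p4_free_def by blast

text \<open>The path on four vertices is self-complementary: the complement of a path
  \<open>a b c d\<close> is the path \<open>c a d b\<close>.\<close>

lemma p4_free_complement:
  assumes "symp R" "p4_free R V"
  shows "p4_free (\<lambda>x y. \<not> R x y) V"
  unfolding p4_free_def
proof (intro notI, elim bexE conjE)
  fix a b c d assume V: "a \<in> V" "b \<in> V" "c \<in> V" "d \<in> V" "distinct [a, b, c, d]"
    and "\<not> R a b" "\<not> R b c" "\<not> R c d" "\<not> \<not> R a c" "\<not> \<not> R b d" "\<not> \<not> R a d"
  then have "distinct [c, a, d, b] \<and> R c a \<and> R a d \<and> R d b \<and> \<not> R c d \<and> \<not> R a b \<and> \<not> R c b"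
    using sympD[OF assms(1)] by auto
  then show False using assms(2) V(1-4) unfolding p4_free_def by blast
qed

text \<open>If \<open>v\<close> has no neighbour in \<open>B\<close>, it can be added to the side
  \<open>A\<close>. Otherwise its non-neighbours in \<open>A\<close> are cut off from all the rest:
  an edge from such a \<open>y\<close> to a neighbour \<open>x\<close> of \<open>v\<close> in
  \<open>A\<close> would start an induced path \<open>y x v z\<close> with \<open>z\<close> in
  \<open>B\<close>.\<close>

lemma split_insert_nonneighbour:
  assumes R: "symp R" "p4_free R (insert v (A \<union> B))"
    and sep: "splits (\<lambda>x y. \<not> R x y) (A \<union> B) A B" and v: "v \<notin> A \<union> B"
    and y: "y \<in> A" "\<not> R v y"
  shows "\<exists>C D. splits (\<lambda>x y. \<not> R x y) (insert v (A \<union> B)) C D"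
proof -
  have sym: "R p q \<Longrightarrow> R q p" for p q using sympD[OF R(1)] by blast
  show ?thesis
  proof (cases "\<exists>z\<in>B. R v z")
    case False
    then have "splits (\<lambda>x y. \<not> R x y) (insert v (A \<union> B)) (insert v A) B"
      using sep v unfolding splits_def by auto
    then show ?thesis by blast
  next
    case True
    then obtain z where z: "z \<in> B" "R v z" by blast
    define M where "M = {y \<in> A. \<not> R v y}"
    have M: "y \<in> A" "\<not> R v y" "y \<noteq> v" if "y \<in> M" for y
      using that v unfolding M_def by auto
    have AB: "\<And>a b. a \<in> A \<Longrightarrow> b \<in> B \<Longrightarrow> \<not> R a b" "A \<inter> B = {}"
      using sep unfolding splits_def by auto
    have no: "\<not> R y x" if "y \<in> M" "x \<in> A" "R v x" for x y
    proof
      assume "R y x"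
      moreover have "distinct [y, x, v, z]"
        using M[OF that(1)] that(2,3) z AB(2) v by auto
      ultimately have "R y v \<or> R x z \<or> R y z"
        using p4_freeD[OF R(2), of y x v z] that M z sym by blast
      then show False using AB(1) M[OF that(1)] that(2) z(1) sym by blast
    qed
    have "\<not> R p q" if p: "p \<in> M" and q: "q \<in> insert v (A \<union> B) - M" for p q
    proof -
      consider "q = v" | "q \<in> B" | "q \<in> A" "R v q" using q unfolding M_def by blast
      then show ?thesis using no[OF p] AB(1) M[OF p] sym by cases blast+
    qed
    then have "splits (\<lambda>x y. \<not> R x y) (insert v (A \<union> B)) M (insert v (A \<union> B) - M)"
      using y v unfolding splits_def M_def by auto
    then show ?thesis by blast
  qed
qed

text \<open>A vertex adjacent to everything splits off as a join factor; any other vertex has a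
  non-neighbour on one of the two sides, whose roles are symmetric.\<close>

lemma split_insert:
  assumes R: "symp R" "p4_free R (insert v V)"
    and sep: "splits (\<lambda>x y. \<not> R x y) V A B" and v: "v \<notin> V"
  shows "\<exists>C D. splits R (insert v V) C D \<or> splits (\<lambda>x y. \<not> R x y) (insert v V) C D"
proof -
  have V: "V = A \<union> B" "V = B \<union> A" using sep unfolding splits_def by auto
  have sep': "splits (\<lambda>x y. \<not> R x y) V B A"
    using sep sympD[OF R(1)] unfolding splits_def by blast
  consider "\<forall>y\<in>V. R v y" | y where "y \<in> A" "\<not> R v y" | y where "y \<in> B" "\<not> R v y"
    using V by blast
  then show ?thesis
  proof cases
    case 1
    then have "splits R (insert v V) {v} V" using sep v unfolding splits_def by auto
    then show ?thesis by blast
  next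
    case 2
    then show ?thesis using split_insert_nonneighbour[of R v A B y] R sep v V(1) by auto
  next
    case 3
    then show ?thesis using split_insert_nonneighbour[of R v B A y] R sep' v V(2) by auto
  qed
qed

lemma p4_free_split:
  assumes "finite V" "2 \<le> card V" "symp R" "p4_free R V"
  shows "\<exists>A B. splits R V A B \<or> splits (\<lambda>x y. \<not> R x y) V A B"
  using assms
proof (induction V rule: finite_induct)
  case empty
  then show ?case by simp
next
  case (insert v V)
  show ?case
  proof (cases "2 \<le> card V")
    case False
    with insert have "card V = 1" by auto
    then obtain w where "V = {w}" by (auto simp: card_1_singleton_iff)
    then have "splits R (insert v V) {v} {w} \<or> splits (\<lambda>x y. \<not> R x y) (insert v V) {v} {w}"
      using insert.hyps unfolding splits_def by auto
    then show ?thesis by blast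
  next
    case True
    then obtain A B where AB: "splits R V A B \<or> splits (\<lambda>x y. \<not> R x y) V A B"
      using insert.IH insert.prems p4_free_subset[of R "insert v V" V] by blast
    then show ?thesis
    proof
      assume sp: "splits R V A B"
      \<comment> \<open>A join is a disjoint union in the complement, which is again symmetric and
        path-free. So \<open>split_insert\<close> is applied to the complement, with its two
        outcomes exchanged.\<close>
      have "symp (\<lambda>x y. \<not> R x y)" using insert.prems(2) unfolding symp_def by blast
      then show ?thesis
        using split_insert[of "\<lambda>x y. \<not> R x y" v V A B] sp insert.hyps
          p4_free_complement[OF insert.prems(2,3)] by auto
    next
      assume "splits (\<lambda>x y. \<not> R x y) V A B"
      then show ?thesis using split_insert[OF insert.prems(2,3)] insert.hyps by blast
    qed
  qed
qed

section \<open>Decomposition into blocks\<close>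

abbreviation adj :: "'a graph \<Rightarrow> 'a \<Rightarrow> 'a \<Rightarrow> bool" where
  "adj G x y \<equiv> {x, y} \<in> edges G"

lemma adj_sym: "adj G x y \<Longrightarrow> adj G y x"
  by (simp add: insert_commute)

lemma symp_adj: "symp (adj G)"
  by (rule sympI) (rule adj_sym)

lemma simple_graphD:
  assumes "simple_graph G" "adj G x y"
  shows "x \<in> verts G" "y \<in> verts G" "x \<noteq> y"
  using assms unfolding simple_graph_def by auto

lemma simple_graph_edgeE:
  assumes "simple_graph G" "e \<in> edges G"
  obtains x y where "e = {x, y}" "x \<in> verts G" "y \<in> verts G" "x \<noteq> y"
  using assms unfolding simple_graph_def by (metis card_2_iff insert_subset)

lemma contains_induced_path4_iff:
  assumes "simple_graph G"
  shows "contains_induced path4 G \<longleftrightarrow> \<not> p4_free (adj G) (verts G)"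
proof
  assume "contains_induced path4 G"
  then obtain f where f: "inj_on f {0,1,2,3::nat} \<and> f ` {0,1,2,3} \<subseteq> verts G \<and>
      (\<forall>u\<in>{0,1,2,3}. \<forall>v\<in>{0,1,2,3}.
        {u, v} \<in> {{0, 1}, {1, 2}, {2, 3}} \<longleftrightarrow> {f u, f v} \<in> edges G)"
    unfolding contains_induced_def path4_def graph.sel ..
  note f = conjunct1[OF f] conjunct1[OF conjunct2[OF f]] conjunct2[OF conjunct2[OF f]]
  have e: "{u, v} \<in> {{0, 1}, {1, 2}, {2, 3}} \<longleftrightarrow> {f u, f v} \<in> edges G"
    if "u \<in> {0,1,2,3}" "v \<in> {0,1,2,3}" for u v
    using bspec[OF bspec[OF f(3) that(1)] that(2)] .
  have "distinct [f 0, f 1, f 2, f 3]" using f(1) by (auto simp: inj_on_def)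
  moreover have "adj G (f 0) (f 1)" "adj G (f 1) (f 2)" "adj G (f 2) (f 3)"
    "\<not> adj G (f 0) (f 2)" "\<not> adj G (f 1) (f 3)" "\<not> adj G (f 0) (f 3)"
    using e[of 0 1] e[of 1 2] e[of 2 3] e[of 0 2] e[of 1 3] e[of 0 3]
    by (simp_all add: doubleton_eq_iff)
  moreover have "f 0 \<in> verts G" "f 1 \<in> verts G" "f 2 \<in> verts G" "f 3 \<in> verts G"
    using f(2) by auto
  ultimately show "\<not> p4_free (adj G) (verts G)" unfolding p4_free_def by blast
next
  assume "\<not> p4_free (adj G) (verts G)"
  then obtain a b c d where V: "a \<in> verts G" "b \<in> verts G" "c \<in> verts G" "d \<in> verts G"
    and dist: "distinct [a, b, c, d]"
    and E: "adj G a b" "adj G b c" "adj G c d" "\<not> adj G a c" "\<not> adj G b d" "\<not> adj G a d"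
    unfolding p4_free_def by blast
  define f where "f = (\<lambda>n::nat. if n = 0 then a else if n = 1 then b else if n = 2 then c else d)"
  have f: "f 0 = a" "f (Suc 0) = b" "f 2 = c" "f 3 = d" by (auto simp: f_def)
  have E': "adj G b a" "adj G c b" "adj G d c" "\<not> adj G c a" "\<not> adj G d b" "\<not> adj G d a"
    using E by (simp_all add: insert_commute)
  \<comment> \<open>\<open>contains_induced\<close> also compares the pairs with
    \<open>u = v\<close>, where \<open>path4\<close> has no edge, so loops must be excluded in
    \<open>G\<close>.\<close>
  have "\<not> adj G x x" for x using simple_graphD(3)[OF assms] by blast
  then have "\<forall>u\<in>{0,1,2,3::nat}. \<forall>v\<in>{0,1,2,3}.
      {u, v} \<in> {{0, 1}, {1, 2}, {2, 3}} \<longleftrightarrow> {f u, f v} \<in> edges G"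
    using E E' by (simp add: f doubleton_eq_iff)
  moreover have "inj_on f {0,1,2,3}" using dist by (auto simp: inj_on_def f)
  moreover have "f ` {0,1,2,3} \<subseteq> verts G" using V by (auto simp: f)
  ultimately show "contains_induced path4 G"
    unfolding contains_induced_def path4_def graph.sel by blast
qed

lemma cograph_iff: "cograph G \<longleftrightarrow> simple_graph G \<and> p4_free (adj G) (verts G)"
  unfolding cograph_def using contains_induced_path4_iff by blast

section \<open>Induced subgraphs and families of blocks\<close>

definition induced :: "'a graph \<Rightarrow> 'a set \<Rightarrow> 'a graph" where
  "induced G W = Graph W {e \<in> edges G. e \<subseteq> W}"

lemma cograph_induced:
  assumes "cograph G" "W \<subseteq> verts G"
  shows "cograph (induced G W)"
proof -
  have "p4_free (adj G) W" using assms p4_free_subset cograph_iff by blast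
  then have "p4_free (adj (induced G W)) W" unfolding p4_free_def induced_def by auto
  moreover have "simple_graph (induced G W)"
    using assms finite_subset unfolding cograph_iff simple_graph_def induced_def by auto
  ultimately show ?thesis by (simp add: cograph_iff induced_def)
qed

text \<open>In a finite simple graph, a connected component that is a join of two nonempty sides.
  Edges inside the sides are unrestricted; \<open>B\<close> is nonempty because \<open>A\<close> is
  and \<open>card A \<le> card B\<close>.\<close>

definition block :: "'a graph \<Rightarrow> 'a set \<Rightarrow> 'a set \<Rightarrow> bool" where
  "block G A B \<longleftrightarrow> A \<union> B \<subseteq> verts G \<and> A \<inter> B = {} \<and> A \<noteq> {} \<and> card A \<le> card B \<and>
     (\<forall>a\<in>A. \<forall>b\<in>B. adj G a b) \<and> (\<forall>x\<in>A \<union> B. \<forall>y. adj G x y \<longrightarrow> y \<in> A \<union> B)"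

text \<open>The last condition asks only for vertices with a neighbour, so isolated vertices may
  stay outside all blocks.\<close>

definition block_family :: "'a graph \<Rightarrow> ('a set \<times> 'a set) set \<Rightarrow> 'a set \<Rightarrow> bool" where
  "block_family G F W \<longleftrightarrow> (\<forall>p\<in>F. block G (fst p) (snd p) \<and> fst p \<union> snd p \<subseteq> W) \<and>
     (\<forall>p\<in>F. \<forall>q\<in>F. p \<noteq> q \<longrightarrow> (fst p \<union> snd p) \<inter> (fst q \<union> snd q) = {}) \<and>
     (\<forall>x\<in>W. \<forall>y. adj G x y \<longrightarrow> (\<exists>p\<in>F. x \<in> fst p \<union> snd p))"

lemma block_family_disjoint:
  assumes "block_family G F W" "(A, B) \<in> F" "(A', B') \<in> F" "(A, B) \<noteq> (A', B')"
  shows "(A \<union> B) \<inter> (A' \<union> B') = {}"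
proof -
  have "\<forall>p\<in>F. \<forall>q\<in>F. p \<noteq> q \<longrightarrow> (fst p \<union> snd p) \<inter> (fst q \<union> snd q) = {}"
    using assms(1) unfolding block_family_def by blast
  from bspec[OF bspec[OF this assms(2)] assms(3)] show ?thesis using assms(4) by simp
qed

lemma block_family_Un:
  assumes "block_family G F W" "block_family G F' W'" "W \<inter> W' = {}"
  shows "block_family G (F \<union> F') (W \<union> W')"
proof -
  have sub: "\<forall>p\<in>F. fst p \<union> snd p \<subseteq> W" "\<forall>p\<in>F'. fst p \<union> snd p \<subseteq> W'"
    using assms(1,2) unfolding block_family_def by auto
  have "(fst p \<union> snd p) \<inter> (fst q \<union> snd q) = {}" if "p \<in> F \<union> F'" "q \<in> F \<union> F'" "p \<noteq> q" for p q
  proof (cases "p \<in> F \<and> q \<in> F \<or> p \<in> F' \<and> q \<in> F'")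
    case True
    then show ?thesis using assms(1,2) that(3) unfolding block_family_def by blast
  next
    case False
    then have "p \<in> F \<and> q \<in> F' \<or> p \<in> F' \<and> q \<in> F" using that by blast
    then have "fst p \<union> snd p \<subseteq> W \<and> fst q \<union> snd q \<subseteq> W' \<or> fst p \<union> snd p \<subseteq> W' \<and> fst q \<union> snd q \<subseteq> W"
      using sub by metis
    then show ?thesis using assms(3) by blast
  qed
  moreover have "\<forall>p\<in>F \<union> F'. block G (fst p) (snd p) \<and> fst p \<union> snd p \<subseteq> W \<union> W'"
    using assms(1,2) unfolding block_family_def by (metis Un_iff le_supI1 le_supI2)
  moreover have "\<forall>x\<in>W \<union> W'. \<forall>y. adj G x y \<longrightarrow> (\<exists>p\<in>F \<union> F'. x \<in> fst p \<union> snd p)"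
    using assms(1,2) unfolding block_family_def by (metis UnE UnI1 UnI2)
  ultimately show ?thesis unfolding block_family_def by simp
qed

text \<open>Strong induction over adjacency-closed sets. A join is a single block once its smaller
  side is put first; the two sides of a disjoint union are again closed, so their families combine.
  A closed set with fewer than two vertices carries no edge and gets the empty family.\<close>

lemma block_family_exists:
  assumes "simple_graph G" "p4_free (adj G) (verts G)"
    and "W \<subseteq> verts G" "\<forall>x\<in>W. \<forall>y. adj G x y \<longrightarrow> y \<in> W"
  shows "\<exists>F. block_family G F W"
  using assms(3,4)
proof (induction "card W" arbitrary: W rule: less_induct)
  case less
  have fin: "finite W"
    using less.prems assms(1) finite_subset unfolding simple_graph_def by blast
  show ?case
  proof (cases "2 \<le> card W")
    case False
    have "\<not> adj G x y" if x: "x \<in> W" for x y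
    proof
      assume a: "adj G x y"
      then have "{x, y} \<subseteq> W" using less.prems x by blast
      then have "card {x, y} \<le> card W" using card_mono fin by blast
      then show False using simple_graphD(3)[OF assms(1) a] False by simp
    qed
    then have "block_family G {} W" unfolding block_family_def by auto
    then show ?thesis by blast
  next
    case True
    have "p4_free (adj G) W" using p4_free_subset assms(2) less.prems(1) by blast
    then obtain A B where "splits (adj G) W A B \<or> splits (\<lambda>x y. \<not> adj G x y) W A B"
      using p4_free_split[OF fin True symp_adj] by blast
    then show ?thesis
    proof
      assume sp: "splits (adj G) W A B"
      then have "block G A B \<or> block G B A"
        using less.prems adj_sym[where G = G] unfolding splits_def block_def by auto
      then obtain A' B' where b: "block G A' B'" "A' \<union> B' = W"
        using sp unfolding splits_def by blast
      then have "block_family G {(A', B')} W" unfolding block_family_def by auto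
      then show ?thesis by blast
    next
      assume sp: "splits (\<lambda>x y. \<not> adj G x y) W A B"
      then have W: "W = A \<union> B" "A \<inter> B = {}" and "A \<subset> W" "B \<subset> W"
        unfolding splits_def by auto
      then have "card A < card W" "card B < card W" using psubset_card_mono[OF fin] by auto
      moreover have "\<forall>x\<in>A. \<forall>y. adj G x y \<longrightarrow> y \<in> A" "\<forall>x\<in>B. \<forall>y. adj G x y \<longrightarrow> y \<in> B"
        using sp less.prems(2) adj_sym[where G = G] unfolding splits_def by blast+
      ultimately obtain F F' where "block_family G F A" "block_family G F' B"
        using less.hyps[of A] less.hyps[of B] less.prems(1) W by auto
      then show ?thesis using block_family_Un W by blast
    qed
  qed
qed

section \<open>Recovering the graph from its blocks up to isomorphism\<close>

lemma graph_iso_sym: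
  assumes "G \<simeq>\<^sub>G H" "\<forall>e\<in>edges G. e \<subseteq> verts G"
  shows "H \<simeq>\<^sub>G G"
proof -
  obtain f where f: "bij_betw f (verts G) (verts H)" "edges H = (`) f ` edges G"
    using assms(1) unfolding graph_iso_def by auto
  define g where "g = inv_into (verts G) f"
  have "g ` f ` e = e" if "e \<in> edges G" for e
    using inv_into_image_cancel[OF bij_betw_imp_inj_on[OF f(1)]] assms(2) that unfolding g_def
    by blast
  then have "edges G = (`) g ` edges H" using f(2) by (auto simp: image_image)
  moreover have "bij_betw g (verts H) (verts G)"
    unfolding g_def by (rule bij_betw_inv_into[OF f(1)])
  ultimately show ?thesis unfolding graph_iso_def by auto
qed

text \<open>The isomorphism is built from the tagged sum back to \<open>G\<close>, where it is
  simply the map \<open>g\<close> that forgets all tags, and is then inverted. Injectivity of the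
  indexing turns different indices into different, hence disjoint, blocks.\<close>

lemma block_family_iso:
  fixes A B :: "'i \<Rightarrow> 'a set"
  assumes G: "simple_graph G" and F: "block_family G ((\<lambda>i. (A i, B i)) ` I) (verts G)"
    and inj: "inj_on (\<lambda>i. (A i, B i)) I"
  shows "G \<simeq>\<^sub>G graph_sum I (\<lambda>i. induced G (A i) \<otimes>\<^sub>G induced G (B i))
    \<oplus>\<^sub>G edgeless (isolated_vertices G)" (is "_ \<simeq>\<^sub>G ?H")
proof -
  define g :: "'i \<times> ('a + 'a) + 'a \<Rightarrow> 'a" where
    "g = case_sum (\<lambda>p. case_sum id id (snd p)) id"
  have g: "g (Inl (i, Inl v)) = v" "g (Inl (i, Inr v)) = v" "g (Inr v) = v" for i v
    by (auto simp: g_def)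
  have bl: "block G (A i) (B i)" if "i \<in> I" for i
    using F that unfolding block_family_def by auto
  have cap: "A i \<inter> B i = {}" if "i \<in> I" for i
    using bl[OF that] unfolding block_def by auto
  have sub: "v \<in> verts G" if "i \<in> I" "v \<in> A i \<or> v \<in> B i" for i v
    using bl[OF that(1)] that(2) unfolding block_def by auto
  have disj: "i = k" if "i \<in> I" "k \<in> I" "v \<in> A i \<union> B i" "v \<in> A k \<union> B k" for i k v
  proof (rule ccontr)
    assume "i \<noteq> k"
    then have "(A i, B i) \<noteq> (A k, B k)" using inj that unfolding inj_on_def by blast
    then have "(A i \<union> B i) \<inter> (A k \<union> B k) = {}"
      using block_family_disjoint[OF F] that(1,2) by blast
    then show False using that by blast
  qed
  have cover: "\<exists>i\<in>I. x \<in> A i \<union> B i" if "adj G x y" for x y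
    using F that simple_graphD(1)[OF G that] unfolding block_family_def by fastforce
  \<comment> \<open>Both sides of a block are nonempty, so each of its vertices has a neighbour on
    the opposite side. Hence the isolated summand shares no vertex with the blocks, as injectivity
    of \<open>g\<close> requires.\<close>
  have "\<exists>y. adj G x y" if i: "i \<in> I" and x: "x \<in> A i \<union> B i" for i x
  proof -
    have "A i \<noteq> {}" "card (A i) \<le> card (B i)" "finite (A i)"
      using bl[OF i] G finite_subset unfolding block_def simple_graph_def by auto
    then have "B i \<noteq> {}" by auto
    then obtain a b where "a \<in> A i" "b \<in> B i" using \<open>A i \<noteq> {}\<close> by blast
    then have "adj G x b \<or> adj G a x" using bl[OF i] x unfolding block_def by auto
    then show ?thesis using adj_sym[where G = G] by blast
  qed
  then have iso: "v \<notin> isolated_vertices G" if "i \<in> I" "v \<in> A i \<union> B i" for i v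
    using that unfolding isolated_vertices_def by fastforce
  have VH: "verts ?H = (SIGMA i:I. A i <+> B i) <+> isolated_vertices G"
    by (simp add: graph_add_def graph_sum_def graph_join_def edgeless_def induced_def)
  have VH_cases: "(\<exists>i v. p = Inl (i, Inl v) \<and> i \<in> I \<and> v \<in> A i) \<or>
      (\<exists>i v. p = Inl (i, Inr v) \<and> i \<in> I \<and> v \<in> B i) \<or> (\<exists>v. p = Inr v \<and> v \<in> isolated_vertices G)"
    if "p \<in> verts ?H" for p
    using that unfolding VH by auto
  have dAA: "i = k" if "i \<in> I" "k \<in> I" "v \<in> A i" "v \<in> A k" for i k v using disj that by blast
  have dBB: "i = k" if "i \<in> I" "k \<in> I" "v \<in> B i" "v \<in> B k" for i k v using disj that by blast
  have dAB: False if "i \<in> I" "k \<in> I" "v \<in> A i" "v \<in> B k" for i k v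
  proof -
    have "i = k" using disj that by blast
    then show False using cap that by blast
  qed
  have "inj_on g (verts ?H)"
  proof (rule inj_onI)
    fix p q assume pq: "p \<in> verts ?H" "q \<in> verts ?H" and "g p = g q"
    then show "p = q"
      using VH_cases[OF pq(1)] VH_cases[OF pq(2)]
      by (elim disjE exE conjE) (auto simp: g dest: dAA dBB dAB iso)
  qed
  moreover have "g ` verts ?H = verts G"
  proof
    show "g ` verts ?H \<subseteq> verts G"
    proof
      fix v assume "v \<in> g ` verts ?H"
      then obtain p where "p \<in> verts ?H" "v = g p" by blast
      with VH_cases[OF this(1)] show "v \<in> verts G"
        using sub by (auto simp: g isolated_vertices_def)
    qed
    show "verts G \<subseteq> g ` verts ?H"
    proof
      fix v assume v: "v \<in> verts G"
      show "v \<in> g ` verts ?H"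
      proof (cases "v \<in> isolated_vertices G")
        case True
        then have "Inr v \<in> verts ?H" unfolding VH by auto
        from imageI[OF this, of g] show ?thesis by (simp only: g)
      next
        case False
        then obtain e where "e \<in> edges G" "v \<in> e" using v unfolding isolated_vertices_def by auto
        moreover from simple_graph_edgeE[OF G this(1)] obtain x y where "e = {x, y}" by metis
        ultimately obtain w where "adj G v w" by (auto intro: adj_sym)
        then obtain i where "i \<in> I" "v \<in> A i \<union> B i" using cover by blast
        then have "Inl (i, Inl v) \<in> verts ?H \<or> Inl (i, Inr v) \<in> verts ?H" unfolding VH by auto
        then have "g (Inl (i, Inl v)) \<in> g ` verts ?H \<or> g (Inl (i, Inr v)) \<in> g ` verts ?H"
          by (meson imageI)
        then show ?thesis by (simp only: g disj_absorb)
      qed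
    qed
  qed
  ultimately have bij: "bij_betw g (verts ?H) (verts G)" unfolding bij_betw_def by blast
  \<comment> \<open>Without tags, the edges of one summand are those of \<open>G\<close> inside
    either side together with all cross pairs; by the block conditions these are exactly the edges
    of \<open>G\<close> in that component.\<close>
  have join_edges: "(`) g ` (`) Inl ` (`) (Pair i) ` edges (induced G (A i) \<otimes>\<^sub>G induced G (B i))
      = {e \<in> edges G. e \<subseteq> A i} \<union> {e \<in> edges G. e \<subseteq> B i} \<union> {{u, v} | u v. u \<in> A i \<and> v \<in> B i}" for i
  proof -
    let ?h = "(`) (\<lambda>x. g (Inl (i, x)))"
    have h: "?h (Inl ` e) = e" "?h (Inr ` e) = e" "?h {Inl u, Inr v} = {u, v}" for e u v
      by (simp_all add: image_image g)
    have "?h ` {{Inl u, Inr v} | u v. u \<in> A i \<and> v \<in> B i} =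
        {?h {Inl u, Inr v} | u v. u \<in> A i \<and> v \<in> B i}"
      by blast
    then have "?h ` edges (induced G (A i) \<otimes>\<^sub>G induced G (B i)) =
        {e \<in> edges G. e \<subseteq> A i} \<union> {e \<in> edges G. e \<subseteq> B i} \<union> {{u, v} | u v. u \<in> A i \<and> v \<in> B i}"
      unfolding graph_join_def induced_def graph.sel image_Un image_image[of ?h] h by simp
    then show ?thesis by (simp add: image_image)
  qed
  have "(`) g ` edges ?H = (\<Union>i\<in>I. (`) g ` (`) Inl ` (`) (Pair i) `
      edges (induced G (A i) \<otimes>\<^sub>G induced G (B i)))"
    by (simp add: graph_add_def graph_sum_def edgeless_def image_UN)
  also have "\<dots> = edges G"
  proof
    show "(\<Union>i\<in>I. (`) g ` (`) Inl ` (`) (Pair i) `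
      edges (induced G (A i) \<otimes>\<^sub>G induced G (B i))) \<subseteq> edges G"
      unfolding join_edges using bl unfolding block_def by blast
    show "edges G \<subseteq> (\<Union>i\<in>I. (`) g ` (`) Inl ` (`) (Pair i) `
      edges (induced G (A i) \<otimes>\<^sub>G induced G (B i)))"
    proof
      fix e assume e: "e \<in> edges G"
      then obtain x y where xy: "e = {x, y}" using simple_graph_edgeE[OF G] by metis
      then obtain i where i: "i \<in> I" "x \<in> A i \<union> B i" using cover e by blast
      then have "y \<in> A i \<union> B i" using bl e xy unfolding block_def by blast
      then have "e \<in> {e \<in> edges G. e \<subseteq> A i} \<union> {e \<in> edges G. e \<subseteq> B i}
          \<union> {{u, v} | u v. u \<in> A i \<and> v \<in> B i}"
        using i e xy by (auto simp: insert_commute)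
      then show "e \<in> (\<Union>i\<in>I. (`) g ` (`) Inl ` (`) (Pair i) `
          edges (induced G (A i) \<otimes>\<^sub>G induced G (B i)))"
        unfolding join_edges using i(1) by blast
    qed
  qed
  finally have "?H \<simeq>\<^sub>G G" using bij unfolding graph_iso_def by auto
  moreover have "\<forall>e\<in>edges ?H. e \<subseteq> verts ?H"
    by (fastforce simp: graph_add_def graph_sum_def graph_join_def edgeless_def induced_def)
  ultimately show ?thesis using graph_iso_sym by blast
qed

section \<open>Bicliques\<close>

text \<open>The inclusions in \<open>verts G\<close> matter when one side is empty: adjacency then
  says nothing about the other side, in accordance with \<open>K_{0,t}\<close> being edgeless on
  \<open>t\<close> vertices.\<close>

definition biclique :: "'a graph \<Rightarrow> 'a set \<Rightarrow> 'a set \<Rightarrow> bool" where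
  "biclique G X Y \<longleftrightarrow> X \<subseteq> verts G \<and> Y \<subseteq> verts G \<and> X \<inter> Y = {} \<and> (\<forall>x\<in>X. \<forall>y\<in>Y. adj G x y)"

lemma contains_complete_bipartite_iff:
  assumes "finite (verts G)"
  shows "contains_subgraph (complete_bipartite m n) G \<longleftrightarrow>
    (\<exists>X Y. biclique G X Y \<and> card X = m \<and> card Y = n)"
proof
  assume "contains_subgraph (complete_bipartite m n) G"
  then obtain f where f: "inj_on f ({..<m} <+> {..<n})" "f ` ({..<m} <+> {..<n}) \<subseteq> verts G"
    and e: "\<forall>e\<in>edges (complete_bipartite m n). f ` e \<in> edges G"
    unfolding contains_subgraph_def complete_bipartite_def graph_join_def edgeless_def by auto
  have e: "adj G (f (Inl u)) (f (Inr v))" if "u < m" "v < n" for u v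
  proof -
    have "{Inl u, Inr v} \<in> edges (complete_bipartite m n)"
      using that unfolding complete_bipartite_def graph_join_def edgeless_def by auto
    then show ?thesis using e by fastforce
  qed
  define X Y where "X = (f \<circ> Inl) ` {..<m}" and "Y = (f \<circ> Inr) ` {..<n}"
  have "inj_on (f \<circ> Inl) {..<m}" "inj_on (f \<circ> Inr) {..<n}" "X \<inter> Y = {}"
    using f(1) unfolding inj_on_def X_def Y_def by fastforce+
  moreover from this have "card X = m" "card Y = n" unfolding X_def Y_def using card_image by fastforce+
  ultimately show "\<exists>X Y. biclique G X Y \<and> card X = m \<and> card Y = n"
    using f(2) e unfolding biclique_def X_def Y_def
    by (intro exI[of _ "(f \<circ> Inl) ` {..<m}"] exI[of _ "(f \<circ> Inr) ` {..<n}"]) auto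
next
  assume "\<exists>X Y. biclique G X Y \<and> card X = m \<and> card Y = n"
  then obtain X Y where XY: "biclique G X Y" "card X = m" "card Y = n" by blast
  then have "finite X" "finite Y" using assms finite_subset unfolding biclique_def by blast+
  then obtain p q where "bij_betw p {..<m} X" "bij_betw q {..<n} Y"
    using XY ex_bij_betw_nat_finite atLeast0LessThan by metis
  then have pq: "inj_on p {..<m}" "p ` {..<m} = X" "inj_on q {..<n}" "q ` {..<n} = Y"
    by (auto simp: bij_betw_def)
  have "inj_on (case_sum p q) ({..<m} <+> {..<n})"
  proof -
    have "p u \<noteq> q v" "q v \<noteq> p u" if "u < m" "v < n" for u v
      using pq(2,4) XY(1) that unfolding biclique_def by auto
    then show ?thesis using pq(1,3) by (auto simp: inj_on_def)
  qed
  moreover have "case_sum p q ` ({..<m} <+> {..<n}) \<subseteq> verts G"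
    using pq XY(1) unfolding biclique_def by auto
  moreover have "\<forall>u<m. \<forall>v<n. adj G (p u) (q v)"
    using pq XY(1) unfolding biclique_def by blast
  ultimately show "contains_subgraph (complete_bipartite m n) G"
    unfolding contains_subgraph_def complete_bipartite_def graph_join_def edgeless_def
    by (intro exI[of _ "case_sum p q"]) auto
qed

text \<open>A bound on a maximum is a bound on every member. Finiteness of the graph makes the set
  of sizes finite, and the default \<open>-\<infinity>\<close> for an empty set matches the vacuous
  condition.\<close>

lemma fulfills_iff:
  assumes "finite (verts G)"
  shows "fulfills G P \<longleftrightarrow> (\<forall>X Y. biclique G X Y \<longrightarrow> ereal (real (card Y)) \<le> P (card X))"
proof -
  have "biclique_seq G m \<le> P m \<longleftrightarrow>
      (\<forall>X Y. biclique G X Y \<longrightarrow> card X = m \<longrightarrow> ereal (real (card Y)) \<le> P m)" for m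
  proof -
    define T where "T = {n. contains_subgraph (complete_bipartite m n) G}"
    have T: "T = {n. \<exists>X Y. biclique G X Y \<and> card X = m \<and> card Y = n}"
      unfolding T_def contains_complete_bipartite_iff[OF assms] by blast
    have "T \<subseteq> {..card (verts G)}"
      unfolding T biclique_def using card_mono[OF assms] by auto
    then have fin: "finite T" using finite_subset by blast
    have seq: "biclique_seq G m = (if T = {} then -\<infinity> else ereal (real (Max T)))"
      unfolding biclique_seq_def T_def Let_def by simp
    have "biclique_seq G m \<le> P m \<longleftrightarrow> (\<forall>n\<in>T. ereal (real n) \<le> P m)"
    proof (cases "T = {}")
      case True
      then show ?thesis using seq by simp
    next
      case False
      then have "Max T \<in> T" "\<And>n. n \<in> T \<Longrightarrow> n \<le> Max T" using fin by auto
      then show ?thesis using seq False by (auto intro: order_trans[of _ "ereal (real (Max T))"])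
    qed
    then show ?thesis unfolding T by blast
  qed
  then show ?thesis unfolding fulfills_def by blast
qed

section \<open>Merging two blocks\<close>

text \<open>The replacement graph, with \<open>A1\<close> as \<open>E\<close> and \<open>A2\<close>
  as \<open>E'\<close>. Only edges meeting \<open>A1 \<union> A2\<close> change; in particular
  \<open>A2\<close> loses its edges to \<open>B2\<close>.\<close>

definition merge :: "'a graph \<Rightarrow> 'a set \<Rightarrow> 'a set \<Rightarrow> 'a set \<Rightarrow> 'a set \<Rightarrow> 'a graph" where
  "merge G A1 B1 A2 B2 = Graph (verts G)
     ({e \<in> edges G. e \<inter> (A1 \<union> A2) = {}} \<union> (\<lambda>(a, v). {a, v}) ` (A1 \<times> (B1 \<union> B2 \<union> A2)))"

lemma verts_merge [simp]: "verts (merge G A1 B1 A2 B2) = verts G"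
  by (simp add: merge_def)

lemma adj_merge_iff:
  "adj (merge G A1 B1 A2 B2) u v \<longleftrightarrow>
     adj G u v \<and> u \<notin> A1 \<union> A2 \<and> v \<notin> A1 \<union> A2 \<or>
     u \<in> A1 \<and> v \<in> B1 \<union> B2 \<union> A2 \<or> v \<in> A1 \<and> u \<in> B1 \<union> B2 \<union> A2"
proof -
  have "{u, v} \<in> (\<lambda>(a, v). {a, v}) ` (A1 \<times> (B1 \<union> B2 \<union> A2)) \<longleftrightarrow>
      u \<in> A1 \<and> v \<in> B1 \<union> B2 \<union> A2 \<or> v \<in> A1 \<and> u \<in> B1 \<union> B2 \<union> A2"
    unfolding image_iff by (auto simp: doubleton_eq_iff)
  then show ?thesis unfolding merge_def by auto
qed

locale two_blocks =
  fixes G :: "'a graph" and A1 B1 A2 B2 :: "'a set"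
  assumes G: "cograph G" and b1: "block G A1 B1" and b2: "block G A2 B2"
    and disj: "(A1 \<union> B1) \<inter> (A2 \<union> B2) = {}" and card_eq: "card A1 = card A2"
begin

abbreviation "H \<equiv> merge G A1 B1 A2 B2"
abbreviation "D \<equiv> B1 \<union> B2 \<union> A2"

lemma simple: "simple_graph G"
  using G by (simp add: cograph_iff)

lemma finite: "finite (verts G)" "finite A1" "finite A2" "finite B1" "finite B2"
  using simple b1 b2 finite_subset unfolding simple_graph_def block_def by auto

lemma disjoint: "A1 \<inter> D = {}" "A2 \<inter> B1 = {}" "A2 \<inter> B2 = {}" "B1 \<inter> B2 = {}"
  using b1 b2 disj unfolding block_def by auto

text \<open>\<open>A1 \<union> D\<close> is the union of the vertex sets of both blocks.\<close>

lemma closed: "adj G x y \<Longrightarrow> x \<in> A1 \<union> D \<longleftrightarrow> y \<in> A1 \<union> D"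
  using b1 b2 adj_sym[of x y G] unfolding block_def by blast

lemma simple_merge: "simple_graph H"
  unfolding simple_graph_def
proof (intro conjI ballI)
  fix e assume "e \<in> edges H"
  then consider "e \<in> edges G" | a v where "e = {a, v}" "a \<in> A1" "v \<in> D"
    unfolding merge_def by auto
  then have "e \<subseteq> verts G \<and> card e = 2"
  proof cases
    case 1
    then show ?thesis using simple unfolding simple_graph_def by blast
  next
    case 2
    then have "a \<noteq> v" using disjoint by blast
    then show ?thesis using 2 b1 b2 unfolding block_def by auto
  qed
  then show "e \<subseteq> verts H" "card e = 2" by auto
qed (simp add: finite)

text \<open>An induced path avoids both \<open>A1\<close> and \<open>A2\<close>, and off these sets
  \<open>merge\<close> leaves adjacency unchanged, so the path would already lie in
  \<open>G\<close>.\<close>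

lemma cograph_merge: "cograph H"
proof -
  have "p4_free (adj H) (verts G)"
    unfolding p4_free_def
  proof (intro notI, elim bexE conjE)
    fix a b c d
    assume V: "a \<in> verts G" "b \<in> verts G" "c \<in> verts G" "d \<in> verts G" and dist: "distinct [a,b,c,d]"
      and H: "adj H a b" "adj H b c" "adj H c d" "\<not> adj H a c" "\<not> adj H b d" "\<not> adj H a d"
    have sym: "adj H x y \<Longrightarrow> adj H y x" for x y by (rule adj_sym)
    have A1: "x \<in> A1 \<Longrightarrow> adj H x y \<longleftrightarrow> y \<in> D" for x y
      unfolding adj_merge_iff using disjoint(1) by blast
    have A2: "x \<in> A2 \<Longrightarrow> adj H x y \<Longrightarrow> y \<in> A1" for x y
      unfolding adj_merge_iff using disjoint(1) by blast
    have cl: "x \<in> D \<Longrightarrow> adj H x y \<Longrightarrow> y \<in> A1 \<or> y \<in> D" for x y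
      unfolding adj_merge_iff using closed[of x y] by blast
    have D: "x \<in> A1 \<Longrightarrow> x \<notin> D" for x using disjoint(1) by blast
    \<comment> \<open>The complement of the path is connected, so a path inside the join of
      \<open>A1\<close> and \<open>D\<close> would lie on one side of it; it cannot lie in
      \<open>A1\<close>, which has become edgeless. A vertex of \<open>A2\<close> is then excluded
      because all its neighbours are in \<open>A1\<close>.\<close>
    have no1: "a \<notin> A1" "b \<notin> A1" "c \<notin> A1" "d \<notin> A1"
      using A1[of a] A1[of b] A1[of c] A1[of d] cl D H sym by metis+
    then have no2: "a \<notin> A2" "b \<notin> A2" "c \<notin> A2" "d \<notin> A2"
      using A2 H(1-3) sym by metis+
    have "adj H x y \<longleftrightarrow> adj G x y" if "x \<in> {a,b,c,d}" "y \<in> {a,b,c,d}" for x y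
      unfolding adj_merge_iff using that no1 no2 by auto
    then have "adj G a b" "adj G b c" "adj G c d" "\<not> adj G a c" "\<not> adj G b d" "\<not> adj G a d"
      using H by auto
    then show False using V dist G unfolding cograph_iff p4_free_def by blast
  qed
  then show ?thesis using simple_merge by (simp add: cograph_iff)
qed

lemma card_edges_merge: "card (edges G) < card (edges H)"
proof -
  define j where "j = card A1"
  define K where "K = {e \<in> edges G. e \<inter> (A1 \<union> A2) = {}}"
  let ?pair = "\<lambda>(a, v). {a, v}"
  let ?C = "\<lambda>A. {e. e \<subseteq> A \<and> card e = 2}"
  have finE: "finite (edges G)"
    using simple finite(1) finite_subset[of "edges G" "Pow (verts G)"]
    unfolding simple_graph_def by blast
  then have finK: "finite K" unfolding K_def by simp
  have j: "0 < j" using b1 finite unfolding j_def block_def by (simp add: card_gt_0_iff)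
  \<comment> \<open>By closedness of the blocks, a lost edge runs inside some \<open>Ai\<close> or
    from \<open>Ai\<close> to \<open>Bi\<close>.\<close>
  have "edges G \<subseteq> K \<union> (?pair ` (A1 \<times> B1) \<union> ?pair ` (A2 \<times> B2) \<union> (?C A1 \<union> ?C A2))"
  proof
    fix e assume e: "e \<in> edges G"
    obtain x y where xy: "e = {x, y}" "x \<noteq> y" using simple_graph_edgeE[OF simple e] by metis
    show "e \<in> K \<union> (?pair ` (A1 \<times> B1) \<union> ?pair ` (A2 \<times> B2) \<union> (?C A1 \<union> ?C A2))"
    proof (cases "e \<in> K")
      case False
      then obtain a v where av: "e = {a, v}" "a \<in> A1 \<union> A2" "a \<noteq> v"
        using e xy unfolding K_def by (auto simp: insert_commute)
      have "card e = 2" using av by simp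
      moreover have "v \<in> A1 \<union> B1" if "a \<in> A1" using b1 e av(1) that unfolding block_def by blast
      moreover have "v \<in> A2 \<union> B2" if "a \<in> A2" using b2 e av(1) that unfolding block_def by blast
      ultimately show ?thesis using av unfolding image_iff by (auto intro: bexI[of _ "(a, v)"])
    qed simp
  qed
  moreover have finC: "finite (?C A1)" "finite (?C A2)" using finite by auto
  ultimately have "card (edges G) \<le>
      card (K \<union> (?pair ` (A1 \<times> B1) \<union> ?pair ` (A2 \<times> B2) \<union> (?C A1 \<union> ?C A2)))"
    using finK finite by (intro card_mono) auto
  also have "\<dots> \<le> card K +
      ((card (?pair ` (A1 \<times> B1)) + card (?pair ` (A2 \<times> B2))) + (card (?C A1) + card (?C A2)))"
    by (intro order_trans[OF card_Un_le] add_mono order_refl card_Un_le)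
  also have "\<dots> \<le> card K + ((j * card B1 + j * card B2) + ((j choose 2) + (j choose 2)))"
  proof -
    have "card (?pair ` (A1 \<times> B1)) \<le> j * card B1" "card (?pair ` (A2 \<times> B2)) \<le> j * card B2"
      using card_image_le[of "A1 \<times> B1" ?pair] card_image_le[of "A2 \<times> B2" ?pair] finite card_eq
      by (auto simp: j_def card_cartesian_product)
    moreover have "card (?C A1) = j choose 2" "card (?C A2) = j choose 2"
      using n_subsets[OF finite(2), of 2] n_subsets[OF finite(3), of 2] card_eq by (simp_all add: j_def)
    ultimately show ?thesis by linarith
  qed
  also have "\<dots> = card K + (j * card B1 + j * card B2) + j * (j - 1)"
  proof -
    have "even (j * (j - 1))" by auto
    then have "2 * (j choose 2) = j * (j - 1)" unfolding choose_two by (rule dvd_mult_div_cancel)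
    then show ?thesis by linarith
  qed
  \<comment> \<open>Here \<open>j * (j - 1) < j * j\<close>, which is strict because
    \<open>j\<close> is positive.\<close>
  also have "\<dots> < card K + j * (card B1 + card B2 + j)"
    using j by (simp add: algebra_simps)
  also have "\<dots> = card (K \<union> ?pair ` (A1 \<times> D))"
  proof -
    \<comment> \<open>Disjointness of \<open>A1\<close> and \<open>D\<close> prevents an edge from
      being counted in both orientations, so the number of new edges is exact.\<close>
    have "inj_on ?pair (A1 \<times> D)"
      using disjoint(1) unfolding inj_on_def by (auto simp: doubleton_eq_iff)
    moreover have "card D = card B1 + card B2 + j"
      using disjoint finite card_eq by (subst card_Un_disjoint card_Un_disjoint; auto simp: j_def)+
    ultimately have "card (?pair ` (A1 \<times> D)) = j * (card B1 + card B2 + j)"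
      by (simp add: card_image card_cartesian_product j_def)
    moreover have "K \<inter> ?pair ` (A1 \<times> D) = {}" unfolding K_def by auto
    ultimately show ?thesis using finK finite by (subst card_Un_disjoint) auto
  qed
  also have "K \<union> ?pair ` (A1 \<times> D) = edges H" by (simp add: K_def merge_def)
  finally show ?thesis .
qed

lemma large_biclique_merge:
  assumes XY: "biclique H X Y" and large: "card A1 < card X" "card A1 < card Y"
  shows "\<exists>X' Y'. biclique G X' Y' \<and> card X' = card X \<and> card Y' = card Y"
proof -
  have "\<not> X \<subseteq> A1" "\<not> Y \<subseteq> A1"
    using large card_mono[OF finite(2), of X] card_mono[OF finite(2), of Y] by auto
  then obtain x0 y0 where x0: "x0 \<in> X" "x0 \<notin> A1" and y0: "y0 \<in> Y" "y0 \<notin> A1" by blast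
  have H: "adj H x y" if "x \<in> X" "y \<in> Y" for x y using XY that unfolding biclique_def by blast
  have sym: "adj G p q \<Longrightarrow> adj G q p" for p q by (rule adj_sym)
  \<comment> \<open>A vertex of \<open>A2\<close> is adjacent in \<open>H\<close> only to
    \<open>A1\<close>, which contains neither \<open>x0\<close> nor \<open>y0\<close>.\<close>
  have x0y0: "adj G x0 y0" "x0 \<notin> A2" "y0 \<notin> A2"
    using H[OF x0(1) y0(1)] x0(2) y0(2) unfolding adj_merge_iff by auto
  \<comment> \<open>Stated for a generic pair so as to serve both \<open>(A1, B1)\<close> and
    \<open>(A2, B2)\<close>. As \<open>x0\<close> lies in \<open>B\<close>, all of \<open>Y\<close>
    lies in \<open>A1 \<union> B\<close>; then \<open>y0\<close> lies in \<open>B\<close> and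
    confines \<open>X\<close> likewise.\<close>
  have transfer: ?thesis
    if "x0 \<in> B" "B \<subseteq> B1 \<union> B2" "block G A B" "card A = card A1" "A \<subseteq> A1 \<union> A2" for A B
  proof -
    have AB: "A \<inter> B = {}" "A1 \<inter> B = {}" using that disjoint unfolding block_def by auto
    have cl: "q \<in> B" if "p \<in> B" "adj G p q" "q \<notin> A1 \<union> A2" for p q
      using that \<open>block G A B\<close> \<open>A \<subseteq> A1 \<union> A2\<close> unfolding block_def by blast
    have sub: "Y \<subseteq> A1 \<union> B"
    proof
      fix y assume "y \<in> Y"
      then show "y \<in> A1 \<union> B"
        using H[OF x0(1)] x0(2) cl[OF that(1)] unfolding adj_merge_iff by blast
    qed
    then have "y0 \<in> B" using y0 by blast
    have sub': "X \<subseteq> A1 \<union> B"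
    proof
      fix x assume "x \<in> X"
      then show "x \<in> A1 \<union> B"
        using H[OF _ y0(1)] y0(2) cl[OF \<open>y0 \<in> B\<close>] sym unfolding adj_merge_iff by blast
    qed
    have "finite A" using that finite by (metis finite_UnI finite_subset)
    from finite_same_card_bij[OF finite(2) this that(4)[symmetric]]
    obtain h where h: "bij_betw h A1 A" by blast
    \<comment> \<open>\<open>k\<close> embeds the part of the merged graph on \<open>A1 \<union> B\<close> into the block \<open>A \<times> B\<close> of \<open>G\<close>.\<close>
    define k where "k = (\<lambda>x. if x \<in> A1 then h x else x)"
    have kA: "k x \<in> A" if "x \<in> A1" for x
      using h that unfolding k_def bij_betw_def by auto
    have kB: "k x = x" if "x \<in> B" for x using that AB unfolding k_def by auto
    have inj: "inj_on k (A1 \<union> B)"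
      using h AB kA kB unfolding bij_betw_def inj_on_def k_def by (auto split: if_splits)
    have "adj G (k x) (k y)" if xy: "x \<in> X" "y \<in> Y" for x y
    proof -
      consider "adj G x y" "x \<in> B" "y \<in> B" | "x \<in> A1" "y \<in> B" | "y \<in> A1" "x \<in> B"
        using H[OF xy] sub sub' xy disjoint(1) unfolding adj_merge_iff by blast
      then show ?thesis
      proof cases
        case 1
        then show ?thesis by (simp add: kB)
      next
        case 2
        then show ?thesis using kA kB \<open>block G A B\<close> unfolding block_def by auto
      next
        case 3
        then have "adj G (k y) (k x)" using kA kB \<open>block G A B\<close> unfolding block_def by auto
        then show ?thesis by (rule sym)
      qed
    qed
    moreover have "k ` X \<subseteq> verts G" "k ` Y \<subseteq> verts G"
      using sub sub' kA kB \<open>block G A B\<close> unfolding block_def by fastforce+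
    moreover have "k ` X \<inter> k ` Y = {}"
      using inj_on_image_Int[OF inj sub' sub] XY unfolding biclique_def by auto
    ultimately have "biclique G (k ` X) (k ` Y)" unfolding biclique_def by blast
    then show ?thesis using card_image inj_on_subset[OF inj] sub sub' by blast
  qed
  show ?thesis
  proof (cases "x0 \<in> B1 \<union> B2")
    case True
    then show ?thesis using transfer[of B1 A1] transfer[of B2 A2] b1 b2 card_eq by auto
  next
    case False
    then have x0D: "x0 \<notin> A1 \<union> D" using x0 x0y0 by blast
    then have y0D: "y0 \<notin> A1 \<union> D" using closed[OF x0y0(1)] by blast
    \<comment> \<open>Since \<open>x0\<close> and \<open>y0\<close> lie outside both blocks, their
      \<open>H\<close>-neighbours avoid \<open>A1 \<union> A2\<close>; so \<open>X\<close> and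
      \<open>Y\<close> live where \<open>H\<close> and \<open>G\<close> agree.\<close>
    have "adj G x y" if "x \<in> X" "y \<in> Y" for x y
      using H[OF that] H[OF x0(1) that(2)] H[OF that(1) y0(1)] x0D y0D
      unfolding adj_merge_iff by blast
    then have "biclique G X Y" using XY unfolding biclique_def by auto
    then show ?thesis by blast
  qed
qed

end

section \<open>Extremal cographs\<close>

text \<open>If \<open>t < s\<close>, then \<open>P t = \<infinity>\<close>, whereas
  \<open>P s < t\<close> and subdiagonality give \<open>P t < s\<close>.\<close>

lemma start_index_le:
  assumes "biclique_profile P" "start_index P s" "P s = ereal (real t - 1)"
  shows "s \<le> t"
proof (rule ccontr)
  assume "\<not> s \<le> t"
  then have "P t = \<infinity>" using assms(2) unfolding start_index_def by auto
  moreover have "P s < ereal (real t)" using assms(3) by simp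
  then have "P t < ereal (real s)" using assms(1) unfolding biclique_profile_def by blast
  ultimately show False by simp
qed

text \<open>If \<open>card A \<ge> t\<close>, then
  \<open>s \<le> t \<le> card A \<le> card B\<close>, so the sides can be cut down to a biclique
  with \<open>s\<close> and \<open>t\<close> vertices, against \<open>P s = t - 1\<close>.\<close>

lemma card_block_less:
  assumes P: "biclique_profile P" "start_index P s" "P s = ereal (real t - 1)"
    and G: "simple_graph G" "fulfills G P" "block G A B"
  shows "card A < t"
proof (rule ccontr)
  assume "\<not> card A < t"
  then have "s \<le> card A" "t \<le> card B"
    using start_index_le[OF P] G(3) unfolding block_def by auto
  then obtain X Y where XY: "X \<subseteq> A" "card X = s" "Y \<subseteq> B" "card Y = t"
    by (metis obtain_subset_with_card_n)
  then have "biclique G X Y" using G(3) unfolding biclique_def block_def by blast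
  then have "ereal (real t) \<le> ereal (real t - 1)"
    using G(1,2) fulfills_iff[of G P] XY P(3) unfolding simple_graph_def by metis
  then show False by simp
qed

lemma extremal_blocks_card_neq:
  assumes P: "biclique_profile P" "start_index P s" and G: "extremal_cograph P G"
    and b: "block G A1 B1" "block G A2 B2" "(A1 \<union> B1) \<inter> (A2 \<union> B2) = {}" and s: "card A1 < s"
  shows "card A1 \<noteq> card A2"
proof
  assume "card A1 = card A2"
  then interpret two_blocks G A1 B1 A2 B2
    using G b by unfold_locales (auto simp: extremal_cograph_def)
  have inf: "P i = \<infinity>" if "i < s" for i using P(2) that unfolding start_index_def by auto
  have GP: "ereal (real (card Y)) \<le> P (card X)" if "biclique G X Y" for X Y
    using assms(3) that fulfills_iff[OF finite(1), of P] unfolding extremal_cograph_def by simp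
  have "ereal (real (card Y)) \<le> P (card X)" if XY: "biclique H X Y" for X Y
  proof -
    \<comment> \<open>Below the start-index the profile is infinite. For small \<open>X\<close> this
      is the bound itself; for small \<open>Y\<close> subdiagonality carries it over from
      \<open>P (card Y)\<close> to \<open>P (card X)\<close>. Otherwise both sides have at least
      \<open>s > card A1\<close> vertices.\<close>
    consider "card X < s" | "card Y < s" | "card A1 < card X" "card A1 < card Y"
      using s by linarith
    then show ?thesis
    proof cases
      case 1
      then show ?thesis using inf by simp
    next
      case 2
      then have "\<not> P (card Y) < ereal (real (card X))" using inf by simp
      then show ?thesis using P(1) unfolding biclique_profile_def by (meson not_le)
    next
      case 3
      then show ?thesis using large_biclique_merge[OF XY] GP by metis
    qed
  qed
  then have "fulfills H P" using fulfills_iff[of H P] finite(1) by simp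
  then have "card (edges H) \<le> card (edges G)"
    using assms(3) cograph_merge unfolding extremal_cograph_def by simp
  then show False using card_edges_merge by simp
qed

theorem theorem5:
  fixes P :: "nat \<Rightarrow> ereal" and s t :: nat and G :: "'a graph"
  assumes "biclique_profile P"
    and "start_index P s"
    and "P s = ereal (real t - 1)"
    and "extremal_cograph P G"
  shows "\<exists>(I :: nat set) (\<sigma> :: nat \<Rightarrow> nat) (G1 :: nat \<Rightarrow> 'a graph) (G2 :: nat \<Rightarrow> 'a graph).
    finite I \<and> \<sigma> \<in> I \<rightarrow> {1..t - 1} \<and>
    (\<forall>i\<in>I. cograph (G1 i) \<and> cograph (G2 i)) \<and>
    G \<simeq>\<^sub>G graph_sum I (\<lambda>i. G1 i \<otimes>\<^sub>G G2 i) \<oplus>\<^sub>G edgeless (isolated_vertices G) \<and>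
    (\<forall>i\<in>I. card (verts (G1 i)) = \<sigma> i \<and> card (verts (G2 i)) \<ge> \<sigma> i) \<and>
    (\<forall>j\<in>{1..s - 1}. card {i \<in> I. \<sigma> i = j} \<le> 1)"
proof -
  have G: "cograph G" "simple_graph G" "p4_free (adj G) (verts G)" "fulfills G P"
    using assms(4) cograph_iff unfolding extremal_cograph_def by auto
  have finV: "finite (verts G)" using G(2) by (simp add: simple_graph_def)
  obtain F where F: "block_family G F (verts G)"
    using block_family_exists[OF G(2,3) subset_refl] simple_graphD(2)[OF G(2)] by blast
  have "F \<subseteq> Pow (verts G) \<times> Pow (verts G)"
    using F unfolding block_family_def by fastforce
  then have finF: "finite F" using finV finite_subset by blast
  \<comment> \<open>The blocks are numbered, since the index set is to consist of natural
    numbers.\<close>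
  then obtain f where "bij_betw f {0..<card F} F" using ex_bij_betw_nat_finite by blast
  then have f: "inj_on f {0..<card F}" "f ` {0..<card F} = F" unfolding bij_betw_def by auto
  define I where "I = {0..<card F}"
  define A B where "A = fst \<circ> f" and "B = snd \<circ> f"
  have AB: "(\<lambda>i. (A i, B i)) = f" by (auto simp: A_def B_def)
  have bl: "block G (A i) (B i)" if "i \<in> I" for i
    using F f(2) that unfolding block_family_def A_def B_def I_def by fastforce
  have sub: "A i \<subseteq> verts G" "B i \<subseteq> verts G" if "i \<in> I" for i
    using bl[OF that] unfolding block_def by auto
  have disj: "(A i \<union> B i) \<inter> (A k \<union> B k) = {}" if "i \<in> I" "k \<in> I" "i \<noteq> k" for i k
  proof (rule block_family_disjoint[OF F])
    show "(A i, B i) \<in> F" "(A k, B k) \<in> F" "(A i, B i) \<noteq> (A k, B k)"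
      using f that fun_cong[OF AB] unfolding I_def inj_on_def by auto
  qed
  have card1: "1 \<le> card (A i)" "card (A i) \<le> card (B i)" if "i \<in> I" for i
    using bl[OF that] sub[OF that] finite_subset[OF _ finV]
    unfolding block_def by (auto simp: Suc_le_eq card_gt_0_iff)
  have card2: "card (A i) \<le> t - 1" if "i \<in> I" for i
    using card_block_less[OF assms(1-3) G(2,4) bl[OF that]] by simp
  \<comment> \<open>Membership in \<open>{1..s - 1}\<close> gives \<open>j < s\<close>; truncated
    subtraction does no harm, as the interval is empty for \<open>s = 0\<close>.\<close>
  have fiber: "card {i \<in> I. card (A i) = j} \<le> 1" if "j \<in> {1..s - 1}" for j
  proof -
    have "i = k" if "i \<in> I" "k \<in> I" "card (A i) = j" "card (A k) = j" for i k
      using extremal_blocks_card_neq[OF assms(1,2,4) bl bl disj, of i k] that \<open>j \<in> {1..s - 1}\<close>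
      by fastforce
    then show ?thesis by (auto simp: card_le_Suc0_iff_eq I_def)
  qed
  have "G \<simeq>\<^sub>G graph_sum I (\<lambda>i. induced G (A i) \<otimes>\<^sub>G induced G (B i))
      \<oplus>\<^sub>G edgeless (isolated_vertices G)"
    using block_family_iso[OF G(2), of A B I] F f unfolding AB I_def by simp
  moreover have "finite I" by (simp add: I_def)
  moreover have "(\<lambda>i. card (A i)) \<in> I \<rightarrow> {1..t - 1}" using card1 card2 by auto
  ultimately show ?thesis
    using cograph_induced[OF G(1)] sub card1 fiber
    by (intro exI[of _ I] exI[of _ "\<lambda>i. card (A i)"] exI[of _ "\<lambda>i. induced G (A i)"]
        exI[of _ "\<lambda>i. induced G (B i)"]) (auto simp: induced_def)
qed

end
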